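(* Let $(k_n)_{n\ge 1}$ be a fixed sequence of positive integers and, for each $n$, let $\theta_{k_n,i_n}:\{0,1\}^{k_n}\to\{0,1\}^{k_n}$ be a fixed bijection. Then any number $x\in[0,1]$ can be represented in the form $$x=\Delta^{(2,(\theta_{k_n,i_n}))}_{\beta_1\beta_2\ldots\beta_n\ldots}=\sum_{j=1}^{\infty}\frac{\beta_j}{2^j},$$ where, for some sequence $(\alpha_j)_{j\ge1}$ of digits $\alpha_j\in\{0,1\}$, $$(\beta_{k_1+\cdots+k_{n-1}+1},\ldots,\beta_{k_1+\cdots+k_n})=\theta_{k_n,i_n}(\alpha_{k_1+\cdots+k_{n-1}+1},\ldots,\alpha_{k_1+\cdots+k_n})\quad\text{for all } n\ge1.$$
   Context: For $n=1$ the sum $k_1+\cdots+k_{n-1}$ is $0$. For a positive integer $k$, the bijections $\{0,1\}^k\to\{0,1\}^k$ (called operators or converters) are enumerated as $\theta_{k,i}$, $i=0,1,\ldots,(2^k)!-1$. The sequence $(\theta_{k_n,i_n})$ is obtained by choosing, for each $n$, one arbitrary operator on $\{0,1\}^{k_n}$. The representation $\Delta^{(2,(\theta_{k_n,i_n}))}_{\beta_1\beta_2\ldots}$ is called the pseudo-binary representation; its value is $\sum_{j\ge1}\beta_j2^{-j}$, with the digits $\beta_j$ obtained blockwise by applying the operators $\theta_{k_n,i_n}$ to consecutive blocks of lengths $k_1,k_2,\ldots$ of a binary digit sequence $(\alpha_j)$. *)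

theory Defs
  imports Complex_Main
begin

text \<open>
  All sequences are indexed from 1, so their value at index 0 is irrelevant.
  Elements of \<open>{0,1}\<^sup>k\<close> are lists of length \<open>k\<close> with entries in \<open>{0,1}\<close>.
\<close>

definition binary_words :: "nat \<Rightarrow> nat list set" where
  "binary_words k = {w. length w = k \<and> set w \<subseteq> {0, 1}}"

definition binary_operator :: "nat \<Rightarrow> (nat list \<Rightarrow> nat list) \<Rightarrow> bool" where
  "binary_operator k \<theta> \<longleftrightarrow> bij_betw \<theta> (binary_words k) (binary_words k)"

definition binary_digits :: "(nat \<Rightarrow> nat) \<Rightarrow> bool" where
  "binary_digits d \<longleftrightarrow> (\<forall>j\<ge>1. d j \<in> {0, 1})"

text \<open>\<open>k\<^sub>1 + \<dots> + k\<^bsub>n-1\<^esub>\<close>, the empty sum for \<open>n = 1\<close>.\<close>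

definition block_offset :: "(nat \<Rightarrow> nat) \<Rightarrow> nat \<Rightarrow> nat" where
  "block_offset k n = (\<Sum>m\<in>{1..<n}. k m)"

definition digit_block :: "(nat \<Rightarrow> nat) \<Rightarrow> (nat \<Rightarrow> nat) \<Rightarrow> nat \<Rightarrow> nat list" where
  "digit_block k d n = map d [block_offset k n + 1 ..< block_offset k n + k n + 1]"

end

theory Submission
  imports Defs
begin

text \<open>
  The operators only relabel digit blocks, so they cannot restrict which digit
  sequences \<open>\<beta>\<close> occur. Expand \<open>x\<close> in base two in the usual way
  (\<open>binary_expansion_exists\<close>) and take that expansion as \<open>\<beta>\<close>. Each operator is
  surjective onto the words of its length, so every block of \<open>\<beta>\<close> has a preimage word.
  Because the block lengths are positive, the blocks partition the positions
  \<open>1, 2, \<dots>\<close>, and the preimage words can be concatenated to a single sequence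
  \<open>\<alpha>\<close> (\<open>prescribed_blocks_exist\<close>).
\<close>

text \<open>
  Scaled remainders of the greedy expansion. The comparison with \<open>1/2\<close> is not strict, so
  the doubling step maps the closed interval \<open>[0,1]\<close> into itself; in particular \<open>1\<close> is a
  fixed point, which produces the expansion \<open>0.111\<dots>\<close> of \<open>1\<close> without a case distinction.
\<close>

primrec binary_remainder :: "real \<Rightarrow> nat \<Rightarrow> real" where
  "binary_remainder x 0 = x"
| "binary_remainder x (Suc n) =
     2 * binary_remainder x n - of_bool (binary_remainder x n \<ge> 1/2)"

lemma binary_remainder_bounds:
  assumes "x \<in> {0..1}"
  shows "binary_remainder x n \<in> {0..1}"
  using assms by (induction n) auto

lemma binary_remainder_partial_sum:
  "(\<Sum>j<n. of_bool (binary_remainder x j \<ge> 1/2) / 2 ^ Suc j) = x - binary_remainder x n / 2 ^ n"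
  by (induction n) (simp_all add: field_simps)

lemma binary_expansion_exists:
  fixes x :: real
  assumes "x \<in> {0..1}"
  obtains \<beta> where "binary_digits \<beta>" "(\<lambda>j. real (\<beta> (Suc j)) / 2 ^ Suc j) sums x"
proof
  let ?\<beta> = "\<lambda>j. of_bool (binary_remainder x (j - 1) \<ge> 1/2) :: nat"
  show "binary_digits ?\<beta>"
    by (simp add: binary_digits_def)
  have "(\<lambda>n. binary_remainder x n / 2 ^ n) \<longlonglongrightarrow> 0"
  proof (rule tendsto_sandwich)
    show "\<forall>\<^sub>F n in sequentially. 0 \<le> binary_remainder x n / 2 ^ n"
      using binary_remainder_bounds[OF assms] by simp
    show "\<forall>\<^sub>F n in sequentially. binary_remainder x n / 2 ^ n \<le> (1/2) ^ n"
      using binary_remainder_bounds[OF assms] by (simp add: power_one_over divide_right_mono)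
    show "(\<lambda>n. (1/2 :: real) ^ n) \<longlonglongrightarrow> 0"
      by (rule LIMSEQ_power_zero) simp
  qed simp
  then have "(\<lambda>n. x - binary_remainder x n / 2 ^ n) \<longlonglongrightarrow> x - 0"
    by (intro tendsto_diff tendsto_const)
  then show "(\<lambda>j. real (?\<beta> (Suc j)) / 2 ^ Suc j) sums x"
    unfolding sums_def by (simp only: binary_remainder_partial_sum of_nat_of_bool diff_Suc_1 diff_0_right)
qed

lemma block_offset_Suc:
  assumes "n \<ge> 1"
  shows "block_offset k (Suc n) = block_offset k n + k n"
  using assms by (simp add: block_offset_def)

lemma block_offset_mono:
  assumes "m \<le> n"
  shows "block_offset k m \<le> block_offset k n"
  unfolding block_offset_def using assms by (intro sum_mono2) auto

lemma le_block_offset_Suc: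
  assumes "\<And>n. n \<ge> 1 \<Longrightarrow> k n > 0"
  shows "j \<le> block_offset k (Suc j)"
proof (induction j)
  case (Suc j)
  then show ?case
    using assms[of "Suc j"] by (simp add: block_offset_Suc)
qed simp

lemma digit_block_binary_word:
  assumes "binary_digits d"
  shows "digit_block k d n \<in> binary_words (k n)"
proof -
  have "d j \<in> {0, 1}" if "j \<in> set [block_offset k n + 1 ..< block_offset k n + k n + 1]" for j
    using assms that by (simp add: binary_digits_def del: upt_Suc)
  then show ?thesis
    by (simp add: digit_block_def binary_words_def image_subset_iff del: upt_Suc)
qed

text \<open>
  Every position lies in exactly one block, so words given block by block determine a digit
  sequence. The block containing position \<open>j\<close> is the first one ending at or after \<open>j\<close>; it
  exists because positive lengths make the offsets grow beyond every bound.
\<close>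

lemma prescribed_blocks_exist:
  assumes pos: "\<And>n. n \<ge> 1 \<Longrightarrow> k n > 0"
    and words: "\<And>n. n \<ge> 1 \<Longrightarrow> w n \<in> binary_words (k n)"
  obtains d where "binary_digits d" "\<And>n. n \<ge> 1 \<Longrightarrow> digit_block k d n = w n"
proof
  define b where "b j = (LEAST n. j \<le> block_offset k (Suc n))" for j
  let ?d = "\<lambda>j. w (b j) ! (j - block_offset k (b j) - 1)"
  show "binary_digits ?d"
    unfolding binary_digits_def
  proof (intro allI impI)
    fix j :: nat assume j: "j \<ge> 1"
    have upper: "j \<le> block_offset k (Suc (b j))"
      unfolding b_def by (rule LeastI) (rule le_block_offset_Suc[OF pos])
    \<comment> \<open>Blocks are counted from 1: the degenerate block 0 ends at offset 0 and contains no position.\<close>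
    have b: "b j \<ge> 1"
      using upper j by (cases "b j") (auto simp: block_offset_def)
    have "\<not> j \<le> block_offset k (Suc (b j - 1))"
      using b not_less_Least[of "b j - 1" "\<lambda>n. j \<le> block_offset k (Suc n)"]
      by (simp add: b_def)
    then have "j - block_offset k (b j) - 1 < length (w (b j))"
      using upper b words[OF b] by (simp add: block_offset_Suc binary_words_def)
    then show "?d j \<in> {0, 1}"
      using words[OF b] nth_mem unfolding binary_words_def by blast
  qed
  fix n :: nat assume n: "n \<ge> 1"
  have block: "b j = n" if "block_offset k n < j" "j \<le> block_offset k n + k n" for j
    unfolding b_def
  proof (rule Least_equality)
    show "j \<le> block_offset k (Suc n)"
      using that n by (simp add: block_offset_Suc)
    show "n \<le> m" if "j \<le> block_offset k (Suc m)" for m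
      using that \<open>block_offset k n < j\<close> block_offset_mono[of "Suc m" n k] by linarith
  qed
  show "digit_block k ?d n = w n"
    using words[OF n]
    by (intro nth_equalityI) (auto simp: digit_block_def binary_words_def block simp del: upt_Suc)
qed

theorem theorem4:
  fixes k :: "nat \<Rightarrow> nat"
    and \<theta> :: "nat \<Rightarrow> nat list \<Rightarrow> nat list"
    and x :: real
  assumes "\<And>n. n \<ge> 1 \<Longrightarrow> k n > 0"
    and "\<And>n. n \<ge> 1 \<Longrightarrow> binary_operator (k n) (\<theta> n)"
    and "x \<in> {0..1}"
  shows "\<exists>\<alpha> \<beta>. binary_digits \<alpha> \<and> binary_digits \<beta> \<and>
           (\<forall>n\<ge>1. digit_block k \<beta> n = \<theta> n (digit_block k \<alpha> n)) \<and>
           (\<lambda>j. real (\<beta> (Suc j)) / 2 ^ Suc j) sums x"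
proof -
  obtain \<beta> where \<beta>: "binary_digits \<beta>" "(\<lambda>j. real (\<beta> (Suc j)) / 2 ^ Suc j) sums x"
    using binary_expansion_exists[OF assms(3)] .
  define w where "w n = inv_into (binary_words (k n)) (\<theta> n) (digit_block k \<beta> n)" for n
  have image: "digit_block k \<beta> n \<in> \<theta> n ` binary_words (k n)" if "n \<ge> 1" for n
    using assms(2)[OF that] digit_block_binary_word[OF \<beta>(1)]
    by (simp add: binary_operator_def bij_betw_def)
  have w: "w n \<in> binary_words (k n)" "\<theta> n (w n) = digit_block k \<beta> n" if "n \<ge> 1" for n
    using image[OF that] by (simp_all add: w_def inv_into_into f_inv_into_f)
  obtain \<alpha> where "binary_digits \<alpha>" "\<And>n. n \<ge> 1 \<Longrightarrow> digit_block k \<alpha> n = w n"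
    using prescribed_blocks_exist[of k w] assms(1) w(1) by blast
  then show ?thesis
    using \<beta> w(2) by metis
qed

end
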